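(* Let $n,k$ be coprime positive integers. The constant $$\mathfrak C_{n,k}=\frac{4(2,n)}{3\varphi(n)}\,\frac{\mathcal S(n;k)}n\prod_{q\nmid2n}\frac{q(q^3-2q^2-q+3)}{(q+1)(q-1)^3}\prod_{\substack{q\mid n\\ q\ne2}}\frac q{q-1}$$ is equal to $2C^{\mathrm{prime}}_{n,k}$, where $$C_{n,k}^{\mathrm{prime}}=\frac1{\varphi(n)}\prod_{q\mid(n,k-1)}\left(1-\frac1{(q-1)^2(q+1)}\right)\prod_{\substack{q\mid n\\ q\nmid k-1}}\left(1-\frac1{(q-1)^2}\right)\prod_{q\nmid n}\left(1-\frac{q^2-q-1}{(q-1)^3(q+1)}\right).$$
   Context: $q$ runs over primes; $\left(\frac\cdot\cdot\right)$ is the Kronecker symbol, $(\cdot,\cdot)$ is the gcd, $\varphi$ is Euler's totient, $v_q$ is the $q$-adic valuation (with $v_q(0)=\infty$); $\delta_{2\mid t}=1$ if $t$ is even and $0$ otherwise. Define $$\mathcal S(n;k)=\sum_{\substack{u\ (\mathrm{mod}\ n)\\ (n,k+1-u)=1}}\ \prod_{\substack{q\mid n\\ q\ne2}}\left(1-\frac{\eta_u(q)}q\right)^{-1}\prod_{\substack{q\mid n\\ q\nmid2u(u-2)}}Q_u(q),$$ where $\eta_u(q)=\left(\frac{u^2-4k}q\right)$ and, with $v=v_q(n)$, $\nu_u=v_q(u^2-4k)$, $\psi_u(q)=\left(\frac{(u^2-4k)/q^{\nu_u}}q\right)$, $$Q_u(q)=\begin{cases}1&\text{if }\nu_u=0,\\[1mm]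 \dfrac{q(q^{\lceil\nu_u/2\rceil}-1)}{q^{\lceil\nu_u/2\rceil}(q-1)}+\dfrac{\delta_{2\mid\nu_u}\,q}{q^{\nu_u/2}(q-\psi_u(q))}&\text{if }0<\nu_u<v,\\[3mm] \dfrac{q(q^{\lceil v/2\rceil}-1)}{q^{\lceil v/2\rceil}(q-1)}+\dfrac{q^{2+v-3\lceil v/2\rceil}}{q^2-1}&\text{if }\nu_u\ge v.\end{cases}$$ (These depend only on $u$ modulo $n$.) *)

theory Defs
  imports "HOL-Analysis.Analysis" "HOL-Number_Theory.Number_Theory" "HOL-Library.Extended_Nat"
begin

definition kronecker_prime :: "int \<Rightarrow> int \<Rightarrow> int" where
  "kronecker_prime a q =
     (if q = 2 then (if even a then 0 else if a mod 8 \<in> {1, 7} then 1 else - 1)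
      else Legendre a q)"

definition kronecker :: "int \<Rightarrow> int \<Rightarrow> int" where
  "kronecker a m =
     (if m = 0 then (if \<bar>a\<bar> = 1 then 1 else 0)
      else (if m < 0 \<and> a < 0 then - 1 else 1) *
           (\<Prod>q\<in>prime_factors m. kronecker_prime a q ^ multiplicity q m))"

(* The library has multiplicity q 0 = 0, whereas the valuation of 0 must be infinite. *)
definition val :: "nat \<Rightarrow> int \<Rightarrow> enat" where
  "val q a = (if a = 0 then \<infinity> else enat (multiplicity (int q) a))"

definition eta :: "nat \<Rightarrow> int \<Rightarrow> nat \<Rightarrow> int" where
  "eta k u q = kronecker (u\<^sup>2 - 4 * int k) (int q)"

definition nu :: "nat \<Rightarrow> int \<Rightarrow> nat \<Rightarrow> enat" where
  "nu k u q = val q (u\<^sup>2 - 4 * int k)"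

(* Meaningful only when nu k u q is finite; then the division is exact. *)
definition psi :: "nat \<Rightarrow> int \<Rightarrow> nat \<Rightarrow> int" where
  "psi k u q = kronecker ((u\<^sup>2 - 4 * int k) div int q ^ the_enat (nu k u q)) (int q)"

(* The last case uses an integer exponent since 2 + v - 3 * ceiling (v/2) can be negative. *)
definition Q :: "nat \<Rightarrow> nat \<Rightarrow> int \<Rightarrow> nat \<Rightarrow> real" where
  "Q n k u q =
     (let v = multiplicity q n;
          m = the_enat (nu k u q);
          a = nat \<lceil>real m / 2\<rceil>;
          b = nat \<lceil>real v / 2\<rceil>
      in if nu k u q = 0 then 1
         else if nu k u q < enat v then
           (real q * (real q ^ a - 1)) / (real q ^ a * (real q - 1))
           + (if even m then real q / (real q ^ (m div 2) * (real q - of_int (psi k u q))) else 0)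
         else
           (real q * (real q ^ b - 1)) / (real q ^ b * (real q - 1))
           + real q powi (2 + int v - 3 * int b) / ((real q)\<^sup>2 - 1))"

definition S :: "nat \<Rightarrow> nat \<Rightarrow> real" where
  "S n k =
     (\<Sum>u\<in>{u\<in>{0..<int n}. gcd (int n) (int k + 1 - u) = 1}.
        (\<Prod>q\<in>{q. prime q \<and> q dvd n \<and> q \<noteq> 2}. inverse (1 - of_int (eta k u q) / real q)) *
        (\<Prod>q\<in>{q. prime q \<and> q dvd n \<and> \<not> int q dvd 2 * u * (u - 2)}. Q n k u q))"

(* Infinite product over the primes satisfying P, in increasing order. *)
definition prime_prod :: "(nat \<Rightarrow> bool) \<Rightarrow> (nat \<Rightarrow> real) \<Rightarrow> real" where
  "prime_prod P f = prodinf (\<lambda>q. if prime q \<and> P q then f q else 1)"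

definition C :: "nat \<Rightarrow> nat \<Rightarrow> real" where
  "C n k =
     (4 * real (gcd 2 n)) / (3 * real (totient n)) * (S n k / real n) *
     prime_prod (\<lambda>q. \<not> q dvd 2 * n)
       (\<lambda>q. (real q * (real q ^ 3 - 2 * (real q)\<^sup>2 - real q + 3)) /
             ((real q + 1) * (real q - 1) ^ 3)) *
     (\<Prod>q\<in>{q. prime q \<and> q dvd n \<and> q \<noteq> 2}. real q / (real q - 1))"

definition C_prime :: "nat \<Rightarrow> nat \<Rightarrow> real" where
  "C_prime n k =
     1 / real (totient n) *
     (\<Prod>q\<in>{q. prime q \<and> int q dvd gcd (int n) (int k - 1)}.
        1 - 1 / ((real q - 1)\<^sup>2 * (real q + 1))) *
     (\<Prod>q\<in>{q. prime q \<and> q dvd n \<and> \<not> int q dvd int k - 1}. 1 - 1 / (real q - 1)\<^sup>2) *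
     prime_prod (\<lambda>q. \<not> q dvd n)
       (\<lambda>q. 1 - ((real q)\<^sup>2 - real q - 1) / ((real q - 1) ^ 3 * (real q + 1)))"

end

theory Submission
  imports Defs
begin

text \<open>
  Both sides are Euler products, so the identity is checked one prime at a time. The work
  lies in the local factors of \<open>S n k\<close>, where sums over \<open>u\<close> modulo \<open>n\<close> have to be evaluated.

  Fix an odd prime \<open>q\<close>, let \<open>v\<close> be its exponent in \<open>n\<close>, and put \<open>D = u\<^sup>2 - 4 k\<close>. The factor
  \<open>(1 - \<eta>/q)\<^sup>-\<^sup>1 Q\<close> depends on \<open>D\<close> modulo \<open>q\<^sup>v\<close> only; as a function \<open>F\<^sub>v D\<close> it is called
  \<open>local_density\<close> below. The long case distinction in its definition hides a short recursion:
  \<open>F\<^sub>v (q\<^sup>2 d) = 1 + F\<^sub>v\<^sub>-\<^sub>2 d / q\<close>, while \<open>F\<^sub>v D = 1\<close> if \<open>q\<close> divides \<open>D\<close> exactly once (and \<open>v > 1\<close>)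
  and \<open>F\<^sub>v D = (1 - \<chi>(D)/q)\<^sup>-\<^sup>1\<close> if \<open>q\<close> does not divide \<open>D\<close>, where \<open>\<chi>\<close> is the Legendre symbol.
  With \<open>c = q\<^sup>2 / (q\<^sup>2 - 1)\<close> the last value is \<open>c (1 + \<chi>(D)/q)\<close>, and the recursion starts from \<open>F\<^sub>0 = c\<close> and from
  \<open>F\<^sub>1 = c\<close> on the multiples of \<open>q\<close>. Since \<open>c = 1 + c/q\<^sup>2\<close>, the recursion
  gives by induction that the average of \<open>F\<^sub>v\<close> over the multiples of \<open>q\<close> modulo \<open>q\<^sup>v\<close> is \<open>c\<close>. Hence in
  every residue class \<open>r\<close> modulo \<open>q\<close> the average of \<open>F\<^sub>v\<close> is \<open>c (1 + \<chi>(r)/q)\<close>.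

  The map \<open>u \<mapsto> u\<^sup>2 - 4 k\<close> preserves these averages: on a class \<open>r\<close> modulo \<open>q\<close> with
  \<open>q dvd r\<^sup>2 - 4 k\<close> its derivative \<open>2 r\<close> is a unit, so it maps the lifts of \<open>r\<close> bijectively to the multiples of
  \<open>q\<close> modulo \<open>q\<^sup>v\<close> (Hensel), and on all other classes \<open>F\<^sub>v\<close> is constant. Therefore the local sum equals
  \<open>q\<^sup>v\<^sup>-\<^sup>1 c \<Sum>\<^sub>r (1 + \<chi>(r\<^sup>2 - 4 k)/q)\<close> over the \<open>r\<close> modulo \<open>q\<close> different from \<open>k + 1\<close>. The complete
  character sum is \<open>-1\<close>, and the omitted residue has \<open>r\<^sup>2 - 4 k = (k - 1)\<^sup>2\<close>, which is where the
  distinction between \<open>q dvd k - 1\<close> and its negation comes from. At \<open>q = 2\<close> the coprimality condition just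
  selects the odd \<open>u\<close>, because \<open>k\<close> is then odd.

  The Chinese remainder theorem (\<open>sum_prod_residues\<close>) turns this into a product formula for \<open>S n k\<close>
  (\<open>S_eq_prod\<close>). The Euler factors at odd primes then agree. The prime \<open>2\<close> contributes the
  constant: for odd \<open>n\<close> the infinite product in \<open>C_prime\<close> has the extra factor \<open>2/3\<close>, and for even \<open>n\<close>
  the same value \<open>2/3\<close> comes from the factor of \<open>C_prime\<close> at the prime \<open>2\<close>, which divides \<open>k - 1\<close>, while in \<open>C\<close> the gcd
  of \<open>2\<close> and \<open>n\<close> cancels the proportion \<open>1/2\<close> of odd \<open>u\<close>.
\<close>

section \<open>Sums over residue systems\<close>

text \<open>A map that is injective modulo \<open>m\<close> permutes the residues. Below this is applied to affine
  maps and, in the Hensel argument, to a quadratic one.\<close>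
lemma sum_residues_reindex:
  fixes m :: int and f :: "int \<Rightarrow> real" and g :: "int \<Rightarrow> int"
  assumes m: "m > 0"
    and f: "\<And>x y. [x = y] (mod m) \<Longrightarrow> f x = f y"
    and g: "\<And>x y. [g x = g y] (mod m) \<Longrightarrow> [x = y] (mod m)"
  shows "(\<Sum>x\<in>{0..<m}. f (g x)) = (\<Sum>x\<in>{0..<m}. f x)"
proof -
  have inj: "inj_on (\<lambda>x. g x mod m) {0..<m}"
    using g by (intro inj_onI) (metis atLeastLessThan_iff cong_def cong_less_imp_eq_int)
  have "(\<lambda>x. g x mod m) ` {0..<m} = {0..<m}"
    using m by (intro endo_inj_surj inj) auto
  then have "bij_betw (\<lambda>x. g x mod m) {0..<m} {0..<m}"
    using inj by (simp add: bij_betw_def)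
  then have "(\<Sum>x\<in>{0..<m}. f (g x mod m)) = (\<Sum>x\<in>{0..<m}. f x)"
    by (rule sum.reindex_bij_betw)
  moreover have "f (g x mod m) = f (g x)" for x
    by (rule f) simp
  ultimately show ?thesis by simp
qed

lemma sum_residues_split:
  fixes a b :: int and f :: "int \<Rightarrow> real"
  assumes a: "a > 0" and b: "b > 0"
  shows "(\<Sum>u\<in>{0..<a * b}. f u) = (\<Sum>r\<in>{0..<a}. \<Sum>t\<in>{0..<b}. f (r + a * t))"
proof -
  have *: "r + a * t < a * b" if "r < a" "t < b" for r t
  proof -
    have "a * t \<le> a * (b - 1)" using that a by (intro mult_left_mono) auto
    with that show ?thesis by (simp add: algebra_simps)
  qed
  have **: "u div a < b" if "u < a * b" for u
  proof -
    have "a * (u div a) < a * b"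
      using that a by (smt (verit) minus_mod_eq_mult_div pos_mod_sign)
    then show ?thesis using a by simp
  qed
  have "(\<Sum>u\<in>{0..<a * b}. f u) = (\<Sum>(r, t)\<in>{0..<a} \<times> {0..<b}. f (r + a * t))"
    using a b
    by (intro sum.reindex_bij_witness[where i = "\<lambda>(r, t). r + a * t" and j = "\<lambda>u. (u mod a, u div a)"])
      (auto simp: * ** pos_imp_zdiv_nonneg_iff)
  then show ?thesis by (simp add: sum.cartesian_product)
qed


text \<open>The Chinese remainder theorem for sums. In the induction step, \<open>u\<close> is written as \<open>r + m\<^sub>i t\<close>: the
  factor at \<open>i\<close> sees only \<open>r\<close>, and for fixed \<open>r\<close> the map \<open>t \<mapsto> r + m\<^sub>i t\<close> permutes the residues modulo
  the product of the other moduli.\<close>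
lemma sum_prod_residues:
  fixes m :: "'i \<Rightarrow> int" and f :: "'i \<Rightarrow> int \<Rightarrow> real"
  assumes "finite A"
    and "\<And>i. i \<in> A \<Longrightarrow> m i > 0"
    and "\<And>i j. i \<in> A \<Longrightarrow> j \<in> A \<Longrightarrow> i \<noteq> j \<Longrightarrow> coprime (m i) (m j)"
    and "\<And>i x y. i \<in> A \<Longrightarrow> [x = y] (mod m i) \<Longrightarrow> f i x = f i y"
  shows "(\<Sum>u\<in>{0..<\<Prod>i\<in>A. m i}. \<Prod>i\<in>A. f i u) = (\<Prod>i\<in>A. \<Sum>u\<in>{0..<m i}. f i u)"
  using assms
proof (induction A rule: finite_induct)
  case empty
  have "{0..<1::int} = {0}" by auto
  then show ?case by simp
next
  case (insert i A)
  define M where "M = (\<Prod>j\<in>A. m j)"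
  have mi: "m i > 0" and M: "M > 0"
    using insert.prems(1) by (auto simp: M_def intro!: prod_pos)
  have cop: "coprime M (m i)"
    unfolding M_def using insert.hyps(2) insert.prems(2)
    by (intro prod_coprime_left) (metis insertCI)
  have per: "(\<Prod>j\<in>A. f j x) = (\<Prod>j\<in>A. f j y)" if "[x = y] (mod M)" for x y
  proof (rule prod.cong[OF refl])
    fix j assume j: "j \<in> A"
    then have "m j dvd M" unfolding M_def using insert.hyps(1) by (rule dvd_prodI[rotated])
    then have "[x = y] (mod m j)" using that by (rule cong_dvd_modulus[rotated])
    then show "f j x = f j y" using insert.prems(3) j by blast
  qed
  have inner: "(\<Sum>t\<in>{0..<M}. \<Prod>j\<in>A. f j (r + m i * t)) = (\<Sum>t\<in>{0..<M}. \<Prod>j\<in>A. f j t)" for r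
  proof (rule sum_residues_reindex[OF M per, where g = "\<lambda>t. r + m i * t"])
    fix x y assume "[r + m i * x = r + m i * y] (mod M)"
    then have "[m i * x = m i * y] (mod M)" by (simp add: cong_add_lcancel)
    then show "[x = y] (mod M)"
      using cop cong_mult_lcancel[of "m i" M x y] by (simp add: coprime_commute)
  qed
  have outer: "f i (r + m i * t) = f i r" for r t
    by (rule insert.prems(3)) (auto simp: cong_def)
  have IH: "(\<Sum>u\<in>{0..<M}. \<Prod>j\<in>A. f j u) = (\<Prod>j\<in>A. \<Sum>u\<in>{0..<m j}. f j u)"
    unfolding M_def using insert.prems by (intro insert.IH) auto
  have "(\<Sum>u\<in>{0..<\<Prod>j\<in>insert i A. m j}. \<Prod>j\<in>insert i A. f j u)
      = (\<Sum>u\<in>{0..<m i * M}. f i u * (\<Prod>j\<in>A. f j u))"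
    using insert.hyps by (simp add: M_def)
  also have "\<dots> = (\<Sum>r\<in>{0..<m i}. f i r * (\<Sum>t\<in>{0..<M}. \<Prod>j\<in>A. f j (r + m i * t)))"
    by (simp add: sum_residues_split[OF mi M] outer sum_distrib_left)
  also have "\<dots> = (\<Sum>r\<in>{0..<m i}. f i r) * (\<Sum>t\<in>{0..<M}. \<Prod>j\<in>A. f j t)"
    by (simp add: inner sum_distrib_right)
  finally show ?case using insert.hyps by (simp add: IH)
qed

section \<open>Character sums of the Legendre symbol\<close>

lemma sum_of_bool_cong:
  fixes m b :: int
  assumes "m > 0"
  shows "(\<Sum>u\<in>{0..<m}. of_bool [u = b] (mod m)) = (1 :: real)"
proof -
  have "(\<Sum>u\<in>{0..<m}. of_bool [u = b] (mod m)) = (\<Sum>u\<in>{0..<m}. if u = b mod m then 1 else 0 :: real)"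
    by (intro sum.cong refl) (auto simp: cong_def)
  also have "\<dots> = 1" using assms by (simp add: sum.delta)
  finally show ?thesis .
qed

lemma sum_square_roots:
  fixes p d :: int
  assumes p: "prime p" "p \<noteq> 2"
  shows "(\<Sum>y\<in>{0..<p}. of_bool [y\<^sup>2 = d] (mod p)) = (1 + Legendre d p :: real)"
proof -
  have p2: "p > 2" using p prime_ge_2_int[of p] by linarith
  have odd: "odd p" using p p2 prime_odd_int by blast
  have card: "(\<Sum>y\<in>{0..<p}. of_bool [y\<^sup>2 = d] (mod p))
      = real (card {y\<in>{0..<p}. [y\<^sup>2 = d] (mod p)})"
    by (simp add: Int_def)
  consider (zero) "[d = 0] (mod p)" | (res) "\<not> [d = 0] (mod p)" "QuadRes p d"
    | (nonres) "\<not> [d = 0] (mod p)" "\<not> QuadRes p d" by blast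
  then show ?thesis
  proof cases
    case zero
    have "[y\<^sup>2 = d] (mod p) \<longleftrightarrow> y = 0" if "y \<in> {0..<p}" for y
    proof -
      have "[y\<^sup>2 = d] (mod p) \<longleftrightarrow> [y\<^sup>2 = 0] (mod p)"
        using zero cong_sym cong_trans by blast
      also have "\<dots> \<longleftrightarrow> p dvd y"
        using p by (simp add: cong_0_iff prime_dvd_power_iff)
      also have "\<dots> \<longleftrightarrow> y = 0" using that by (auto dest: zdvd_imp_le)
      finally show ?thesis .
    qed
    then have "{y\<in>{0..<p}. [y\<^sup>2 = d] (mod p)} = {0}" using p2 cong_sym[OF zero] by auto
    then show ?thesis using zero card by (simp add: Legendre_def)
  next
    case res
    then obtain w where w: "[w\<^sup>2 = d] (mod p)" by (auto simp: QuadRes_def)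
    define a where "a = w mod p"
    have a2: "[a\<^sup>2 = d] (mod p)" using w by (simp add: a_def cong_def power_mod)
    have a0: "a \<noteq> 0" using a2 res(1) by (auto simp: cong_def)
    then have a: "0 < a" "a < p"
      using p2 pos_mod_sign[of p w] pos_mod_bound[of p w] by (auto simp: a_def order_less_le)
    have "[y\<^sup>2 = d] (mod p) \<longleftrightarrow> y = a \<or> y = p - a" if "y \<in> {0..<p}" for y
    proof -
      have "[y\<^sup>2 = d] (mod p) \<longleftrightarrow> [y\<^sup>2 = a\<^sup>2] (mod p)"
        using a2 cong_sym cong_trans by blast
      also have "\<dots> \<longleftrightarrow> p dvd (y - a) * (y + a)"
        by (simp add: cong_iff_dvd_diff power2_eq_square algebra_simps)
      also have "\<dots> \<longleftrightarrow> p dvd y - a \<or> p dvd y + a"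
        using p by (simp add: prime_dvd_mult_iff)
      also have "p dvd y - a \<longleftrightarrow> y = a"
      proof -
        have "p dvd y - a \<longleftrightarrow> [y = a] (mod p)" by (simp add: cong_iff_dvd_diff)
        then show ?thesis using that a by (auto simp: cong_def)
      qed
      also have "p dvd y + a \<longleftrightarrow> y = p - a"
      proof -
        have "p dvd y + a \<longleftrightarrow> [y = p - a] (mod p)"
          using dvd_add_right_iff[of p "-p" "y + a"]
          by (simp add: cong_iff_dvd_diff algebra_simps)
        then show ?thesis using that a cong_less_imp_eq_int[of y p "p - a"] by auto
      qed
      finally show ?thesis .
    qed
    then have "{y\<in>{0..<p}. [y\<^sup>2 = d] (mod p)} = {a, p - a}" using a by auto
    moreover have "a \<noteq> p - a" using odd by presburger
    ultimately show ?thesis using res card by (simp add: Legendre_def)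
  next
    case nonres
    then have "{y\<in>{0..<p}. [y\<^sup>2 = d] (mod p)} = {}" by (auto simp: QuadRes_def)
    then show ?thesis using nonres card by (simp add: Legendre_def)
  qed
qed

text \<open>Every \<open>y\<close> is a square root of exactly one residue \<open>d\<close>, so the root counts \<open>1 + \<chi>(d)\<close> add up
  to \<open>p\<close>.\<close>
lemma sum_Legendre:
  fixes p :: int
  assumes p: "prime p" "p \<noteq> 2"
  shows "(\<Sum>d\<in>{0..<p}. real_of_int (Legendre d p)) = 0"
proof -
  have p0: "p > 0" using p prime_gt_0_int by blast
  have "(\<Sum>d\<in>{0..<p}. 1 + real_of_int (Legendre d p))
      = (\<Sum>d\<in>{0..<p}. \<Sum>y\<in>{0..<p}. of_bool [y\<^sup>2 = d] (mod p))"
    by (simp add: sum_square_roots[OF p])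
  also have "\<dots> = (\<Sum>y\<in>{0..<p}. \<Sum>d\<in>{0..<p}. of_bool [d = y\<^sup>2] (mod p))"
    by (subst sum.swap) (simp add: cong_sym_eq)
  also have "\<dots> = (\<Sum>y\<in>{0..<p}. 1)"
    using sum_of_bool_cong[OF p0] by (intro sum.cong refl) blast
  also have "\<dots> = real_of_int p" using p0 by simp
  finally show ?thesis using p0 by (simp add: sum.distrib)
qed

text \<open>The equation is \<open>x\<^sup>2 - u x + k = 0\<close>, written so that it is visibly linear in \<open>u\<close>; completing the
  square, \<open>y = 2 x - u\<close>, reduces the count of its roots to a count of square roots of the discriminant.\<close>
lemma sum_quadratic_roots:
  fixes p u k :: int
  assumes p: "prime p" "p \<noteq> 2"
  shows "(\<Sum>x\<in>{0..<p}. of_bool [x * u = x\<^sup>2 + k] (mod p)) = (1 + Legendre (u\<^sup>2 - 4 * k) p :: real)"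
proof -
  have p0: "p > 0" using p prime_gt_0_int by blast
  have cop2: "coprime 2 p" using p by (intro primes_coprime) auto
  have cop4: "coprime 4 p" using cop2 coprime_mult_left_iff[of 2 2 p] by simp
  have "[x * u = x\<^sup>2 + k] (mod p) \<longleftrightarrow> [(2 * x - u)\<^sup>2 = u\<^sup>2 - 4 * k] (mod p)" for x
  proof -
    have "(2 * x - u)\<^sup>2 - (u\<^sup>2 - 4 * k) = 4 * (- (x * u - (x\<^sup>2 + k)))"
      by (simp add: power2_eq_square algebra_simps)
    then have "[(2 * x - u)\<^sup>2 = u\<^sup>2 - 4 * k] (mod p) \<longleftrightarrow> p dvd 4 * (- (x * u - (x\<^sup>2 + k)))"
      by (simp only: cong_iff_dvd_diff)
    also have "\<dots> \<longleftrightarrow> p dvd x * u - (x\<^sup>2 + k)"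
      using cop4 by (simp only: coprime_dvd_mult_right_iff coprime_commute[of p 4] dvd_minus_iff)
    finally show ?thesis by (simp only: cong_iff_dvd_diff)
  qed
  then have "(\<Sum>x\<in>{0..<p}. of_bool [x * u = x\<^sup>2 + k] (mod p))
      = (\<Sum>x\<in>{0..<p}. of_bool [(2 * x - u)\<^sup>2 = u\<^sup>2 - 4 * k] (mod p) :: real)"
    by simp
  also have "\<dots> = (\<Sum>y\<in>{0..<p}. of_bool [y\<^sup>2 = u\<^sup>2 - 4 * k] (mod p))"
  proof (rule sum_residues_reindex[OF p0, where g = "\<lambda>x. 2 * x - u"])
    fix x y assume "[x = y] (mod p)"
    then have "[x\<^sup>2 = y\<^sup>2] (mod p)" by (rule cong_pow)
    then show "(of_bool [x\<^sup>2 = u\<^sup>2 - 4 * k] (mod p) :: real) = of_bool [y\<^sup>2 = u\<^sup>2 - 4 * k] (mod p)"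
      by (simp add: cong_def)
  next
    fix x y assume "[2 * x - u = 2 * y - u] (mod p)"
    then have "p dvd 2 * (x - y)" by (simp add: cong_iff_dvd_diff algebra_simps)
    then show "[x = y] (mod p)"
      using cop2 by (metis cong_iff_dvd_diff coprime_commute coprime_dvd_mult_right_iff)
  qed
  finally show ?thesis by (simp add: sum_square_roots[OF p])
qed

text \<open>Double counting of the pairs \<open>(u, x)\<close> with \<open>x\<^sup>2 - u x + k = 0\<close>. For fixed \<open>u\<close> there are
  \<open>1 + \<chi>(u\<^sup>2 - 4 k)\<close> of them; for fixed \<open>x\<close> there is exactly one, \<open>u = x + k/x\<close>, unless \<open>x = 0\<close>, which is
  impossible as \<open>k\<close> is a unit. So the total is \<open>p - 1\<close>.\<close>
lemma sum_Legendre_discriminant: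
  fixes p k :: int
  assumes p: "prime p" "p \<noteq> 2" and k: "\<not> p dvd k"
  shows "(\<Sum>u\<in>{0..<p}. real_of_int (Legendre (u\<^sup>2 - 4 * k) p)) = - 1"
proof -
  have p0: "p > 0" using p prime_gt_0_int by blast
  have inner: "(\<Sum>u\<in>{0..<p}. of_bool [x * u = x\<^sup>2 + k] (mod p)) = (if x = 0 then 0 else 1 :: real)"
    if x: "x \<in> {0..<p}" for x
  proof (cases "x = 0")
    case True
    then show ?thesis using k by (simp add: cong_sym_eq[of 0] cong_0_iff)
  next
    case False
    then have "\<not> p dvd x" using x by (auto dest: zdvd_imp_le)
    then have cop: "coprime x p" using p by (metis coprime_commute prime_imp_coprime)
    have "(\<Sum>u\<in>{0..<p}. of_bool [x * u = x\<^sup>2 + k] (mod p))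
        = (\<Sum>u\<in>{0..<p}. of_bool [u = x\<^sup>2 + k] (mod p) :: real)"
    proof (rule sum_residues_reindex[OF p0, where g = "\<lambda>u. x * u"])
      fix u y assume "[x * u = x * y] (mod p)"
      then show "[u = y] (mod p)" using cop by (simp add: cong_mult_lcancel)
    qed (simp add: cong_def)
    then show ?thesis using False by (simp add: sum_of_bool_cong[OF p0])
  qed
  have "(\<Sum>u\<in>{0..<p}. 1 + real_of_int (Legendre (u\<^sup>2 - 4 * k) p))
      = (\<Sum>u\<in>{0..<p}. \<Sum>x\<in>{0..<p}. of_bool [x * u = x\<^sup>2 + k] (mod p))"
    by (simp add: sum_quadratic_roots[OF p])
  also have "\<dots> = (\<Sum>x\<in>{0..<p}. \<Sum>u\<in>{0..<p}. of_bool [x * u = x\<^sup>2 + k] (mod p))"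
    by (rule sum.swap)
  also have "\<dots> = (\<Sum>x\<in>{0..<p}. if x = 0 then 0 else 1)"
    by (intro sum.cong inner refl)
  also have "\<dots> = (\<Sum>x\<in>{0..<p}. 1 - (if x = 0 then 1 else 0))"
    by (intro sum.cong) auto
  also have "\<dots> = real_of_int p - 1" using p0 by (simp add: sum_subtractf)
  finally show ?thesis using p0 by (simp add: sum.distrib)
qed

section \<open>The local density and its recursion\<close>

lemma Legendre_cong:
  assumes "[a = b] (mod p)"
  shows "Legendre a p = Legendre b p"
proof -
  have "[y = a] (mod p) \<longleftrightarrow> [y = b] (mod p)" for y
    using assms cong_sym cong_trans by blast
  moreover have "[a = 0] (mod p) \<longleftrightarrow> [b = 0] (mod p)"
    using assms cong_sym cong_trans by blast
  ultimately show ?thesis by (simp add: Legendre_def QuadRes_def)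
qed

text \<open>The geometric sum \<open>1 + 1/q + \<dots> + 1/q\<^sup>a\<^sup>-\<^sup>1\<close>, in the closed form that occurs in \<open>Q\<close>.\<close>
definition geometric :: "nat \<Rightarrow> nat \<Rightarrow> real" where
  "geometric q a = real q * (real q ^ a - 1) / (real q ^ a * (real q - 1))"

lemma geometric_0 [simp]: "geometric q 0 = 0"
  by (simp add: geometric_def)

lemma geometric_Suc:
  assumes "q > 1"
  shows "geometric q (Suc a) = 1 + geometric q a / real q"
  using assms by (simp add: geometric_def field_simps)

text \<open>The function \<open>F\<^sub>v\<close> of the introduction. The first branch is the case \<open>0 < \<nu> < v\<close> of \<open>Q\<close>, but it is used
  for \<open>\<nu> = 0\<close> as well: there it gives \<open>q / (q - \<chi>(d))\<close>, which is the factor \<open>(1 - \<eta>/q)\<^sup>-\<^sup>1\<close> by which \<open>Q\<close> is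
  multiplied. For \<open>\<nu> > 0\<close> that factor is \<open>1\<close>, so one formula covers the product in all cases. The test
  \<open>d \<noteq> 0\<close> is needed because \<open>multiplicity\<close> is \<open>0\<close>, not infinite, at \<open>0\<close>.\<close>
definition local_density :: "nat \<Rightarrow> nat \<Rightarrow> int \<Rightarrow> real" where
  "local_density q v d =
     (let m = multiplicity (int q) d; b = (v + 1) div 2
      in if d \<noteq> 0 \<and> m < v
         then geometric q ((m + 1) div 2)
           + (if even m
              then real q / (real q ^ (m div 2) * (real q - of_int (Legendre (d div int q ^ m) (int q))))
              else 0)
         else geometric q b + real q powi (2 + int v - 3 * int b) / ((real q)\<^sup>2 - 1))"

text \<open>The average of \<open>local_density q v\<close> over all residues modulo \<open>q\<^sup>v\<close>, for every \<open>v\<close>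
  and every odd prime \<open>q\<close>; see \<open>sum_local_density\<close>.\<close>
abbreviation mean_density :: "nat \<Rightarrow> real" where
  "mean_density q \<equiv> (real q)\<^sup>2 / ((real q)\<^sup>2 - 1)"

lemma prime_square_gt_1:
  assumes "prime (q :: nat)"
  shows "(real q)\<^sup>2 - 1 > 0"
  using prime_gt_1_nat[OF assms] one_less_power[of "real q" 2] by simp

lemma local_density_0: "local_density q 0 d = mean_density q"
  by (simp add: local_density_def)

lemma local_density_unit:
  assumes "v > 0" "\<not> int q dvd d"
  shows "local_density q v d = real q / (real q - of_int (Legendre d (int q)))"
proof -
  have "multiplicity (int q) d = 0" using assms(2) by (rule not_dvd_imp_multiplicity_0)
  moreover have "d \<noteq> 0" using assms(2) by auto
  ultimately show ?thesis using assms(1) by (simp add: local_density_def)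
qed

text \<open>For \<open>\<chi> = 1\<close> and \<open>\<chi> = -1\<close> the value \<open>1/(1 - \<chi>/q)\<close> equals \<open>(1 + \<chi>/q) / (1 - 1/q\<^sup>2)\<close>, which is linear in
  \<open>\<chi>\<close> and can therefore be summed with the help of character sums.\<close>
lemma local_density_unit_eq_mean:
  assumes "prime q" "v > 0" "\<not> int q dvd d"
  shows "local_density q v d = mean_density q * (1 + of_int (Legendre d (int q)) / real q)"
proof -
  have frac: "x / (x - e) = x\<^sup>2 / (x\<^sup>2 - 1) * (1 + e / x)" if "x > 1" "e = 1 \<or> e = - 1" for x e :: real
  proof -
    have "x - 1 \<noteq> 0" "x + 1 \<noteq> 0" "x \<noteq> 0" using that by auto
    moreover have "x\<^sup>2 - 1 = (x - 1) * (x + 1)" by (simp add: power2_eq_square algebra_simps)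
    ultimately show ?thesis using that(2) by (auto simp: divide_simps power2_eq_square)
  qed
  from assms(3) have "Legendre d (int q) = 1 \<or> Legendre d (int q) = - 1"
    by (auto simp: Legendre_def cong_0_iff)
  then have "of_int (Legendre d (int q)) = (1 :: real) \<or> of_int (Legendre d (int q)) = (- 1 :: real)"
    by auto
  then have "real q / (real q - of_int (Legendre d (int q)))
      = mean_density q * (1 + of_int (Legendre d (int q)) / real q)"
    using prime_gt_1_nat[OF assms(1)] by (intro frac) simp_all
  then show ?thesis using assms local_density_unit by simp
qed

lemma local_density_1:
  assumes "prime q" "int q dvd d"
  shows "local_density q (Suc 0) d = mean_density q"
proof -
  have "d = 0 \<or> multiplicity (int q) d \<noteq> 0"
    using assms by (cases "d = 0") (auto simp: prime_elem_multiplicity_eq_zero_iff)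
  then have "local_density q (Suc 0) d = geometric q 1 + 1 / ((real q)\<^sup>2 - 1)"
    by (auto simp: local_density_def)
  also have "geometric q 1 = 1"
    using geometric_Suc[of q 0] prime_gt_1_nat[OF assms(1)] by simp
  also have "1 + 1 / (x - 1) = x / (x - 1)" if "x - 1 > 0" for x :: real
    using that by (simp add: field_simps)
  note this[OF prime_square_gt_1[OF assms(1)]]
  finally show ?thesis .
qed

lemma local_density_exact:
  assumes "prime q" "v \<ge> 2" "int q dvd d" "\<not> (int q)\<^sup>2 dvd d"
  shows "local_density q v d = 1"
proof -
  have "multiplicity (int q) d = 1"
    using assms by (intro multiplicity_eqI) (auto simp: numeral_2_eq_2)
  moreover have "d \<noteq> 0" using assms by auto
  ultimately show ?thesis
    using assms prime_gt_1_nat[OF assms(1)] geometric_Suc[of q 0] by (simp add: local_density_def)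
qed

text \<open>Passing from \<open>d\<close> to \<open>q\<^sup>2 d\<close> and from \<open>v\<close> to \<open>v + 2\<close> lengthens the geometric sum by one
  term and divides the remaining summand by \<open>q\<close>. The quotient \<open>d / q\<^sup>\<nu>\<close> inside the Legendre symbol and the
  parity of \<open>\<nu>\<close> stay the same.\<close>
lemma local_density_step:
  assumes q: "prime q"
  shows "local_density q (Suc (Suc v)) ((int q)\<^sup>2 * d) = 1 + local_density q v d / real q"
proof -
  have q1: "q > 1" using q prime_gt_1_nat by blast
  have powi: "real q powi (2 + int (Suc (Suc v)) - 3 * int ((Suc (Suc v) + 1) div 2))
      = real q powi (2 + int v - 3 * int ((v + 1) div 2)) / real q"
  proof -
    have "2 + int (Suc (Suc v)) - 3 * int ((Suc (Suc v) + 1) div 2)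
        = 2 + int v - 3 * int ((v + 1) div 2) - 1" by simp
    then show ?thesis
      using q1 power_int_diff[of "real q" "2 + int v - 3 * int ((v + 1) div 2)" 1]
      by (simp only:) simp
  qed
  show ?thesis
  proof (cases "d = 0")
    case True
    show ?thesis using powi True q1 by (simp add: local_density_def Let_def geometric_Suc add_divide_distrib)
  next
    case False
    define m where "m = multiplicity (int q) d"
    have m: "multiplicity (int q) ((int q)\<^sup>2 * d) = Suc (Suc m)"
      using False q1 q by (simp add: m_def power2_eq_square mult.assoc multiplicity_times_same)
    have dv: "(int q)\<^sup>2 * d div (int q * (int q * int q ^ m)) = d div int q ^ m"
      using q1 by (simp add: power2_eq_square mult.assoc)
    show ?thesis using powi False q1
      by (simp add: local_density_def Let_def m dv m_def[symmetric] geometric_Suc add_divide_distrib)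
  qed
qed

text \<open>By induction along the recursion: for \<open>v > 0\<close> the residue of \<open>x\<close> modulo \<open>q\<^sup>v\<close> determines \<open>\<chi>(x)\<close> and, for \<open>v > 1\<close>,
  divisibility by \<open>q\<^sup>2\<close>; a congruence between multiples of \<open>q\<^sup>2\<close> becomes, after division, one modulo \<open>q\<^sup>v\<^sup>-\<^sup>2\<close>.\<close>
lemma local_density_cong:
  assumes q: "prime q" and "[x = y] (mod int q ^ v)"
  shows "local_density q v x = local_density q v y"
  using assms(2)
proof (induction v arbitrary: x y rule: induct_nat_012)
  case 0
  then show ?case by (simp add: local_density_0)
next
  case 1
  have dvd: "int q dvd x \<longleftrightarrow> int q dvd y" using 1 by (simp add: cong_dvd_iff)
  show ?case
  proof (cases "int q dvd x")
    case True
    then show ?thesis using dvd by (simp add: local_density_1[OF q])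
  next
    case False
    then show ?thesis using dvd 1 Legendre_cong[of x y "int q"] by (simp add: local_density_unit)
  qed
next
  case (ge2 v)
  have congq: "[x = y] (mod int q)" and congq2: "[x = y] (mod (int q)\<^sup>2)"
    using ge2.prems by (auto elim!: cong_dvd_modulus simp: power2_eq_square)
  have dvd: "int q dvd x \<longleftrightarrow> int q dvd y" "(int q)\<^sup>2 dvd x \<longleftrightarrow> (int q)\<^sup>2 dvd y"
    using congq congq2 by (simp_all add: cong_dvd_iff)
  consider "\<not> int q dvd x" | "int q dvd x" "\<not> (int q)\<^sup>2 dvd x" | "(int q)\<^sup>2 dvd x" by blast
  then show ?case
  proof cases
    case 1
    then show ?thesis using dvd congq Legendre_cong[of x y "int q"] by (simp add: local_density_unit)
  next
    case 2
    then show ?thesis using dvd by (simp add: local_density_exact[OF q])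
  next
    case 3
    then obtain x' y' where xy: "x = (int q)\<^sup>2 * x'" "y = (int q)\<^sup>2 * y'" using dvd by (auto elim!: dvdE)
    have "(int q)\<^sup>2 * int q ^ v dvd (int q)\<^sup>2 * (x' - y')"
      using ge2.prems by (simp add: cong_iff_dvd_diff xy algebra_simps power2_eq_square)
    then have "[x' = y'] (mod int q ^ v)"
      using prime_gt_0_nat[OF q] by (simp add: cong_iff_dvd_diff)
    then show ?thesis unfolding xy local_density_step[OF q] using ge2.IH(1) by simp
  qed
qed

section \<open>Averages of the local density\<close>

text \<open>Among the multiples \<open>q s\<close>, those with \<open>s\<close> prime to \<open>q\<close> have density \<open>1\<close>; the others are \<open>q\<^sup>2 t\<close> and are
  handled by the recursion. Writing \<open>c\<close> for \<open>mean_density q\<close>, the average over \<open>s\<close> is \<open>1 + c/q\<^sup>2\<close>, which is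
  \<open>c\<close> again. The full average for the exponent that is smaller by two enters as a hypothesis so that this lemma
  can be used inside the induction that proves \<open>sum_local_density\<close>.\<close>
lemma sum_local_density_multiples:
  assumes q: "prime q"
    and full: "\<And>w. v = Suc w \<Longrightarrow> (\<Sum>d\<in>{0..<int q ^ w}. local_density q w d) = real q ^ w * mean_density q"
  shows "(\<Sum>s\<in>{0..<int q ^ v}. local_density q (Suc v) (int q * s)) = real q ^ v * mean_density q"
proof (cases v)
  case 0
  have "{0..<1::int} = {0}" by auto
  then show ?thesis using 0 by (simp add: local_density_1[OF q])
next
  case (Suc w)
  have q0: "int q > 0" "real q > 0" using prime_gt_0_nat[OF q] by auto
  have q2: "(real q)\<^sup>2 - 1 > 0" using prime_square_gt_1[OF q] .
  have summand: "local_density q (Suc v) (int q * (r + int q * t))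
      = 1 + (if r = 0 then local_density q w t / real q else 0)" if r: "r \<in> {0..<int q}" for r t
  proof (cases "r = 0")
    case True
    have "int q * (r + int q * t) = (int q)\<^sup>2 * t" using True by (simp add: power2_eq_square)
    then show ?thesis using True local_density_step[OF q, of w t] by (simp only: Suc simp_thms if_True)
  next
    case False
    then have "\<not> int q dvd r" using r by (auto dest: zdvd_imp_le)
    then have "\<not> int q dvd r + int q * t" by (simp add: dvd_add_left_iff)
    then have "\<not> (int q)\<^sup>2 dvd int q * (r + int q * t)"
      using q0 by (simp add: power2_eq_square)
    then show ?thesis using False Suc by (simp add: local_density_exact[OF q])
  qed
  have "(\<Sum>s\<in>{0..<int q ^ v}. local_density q (Suc v) (int q * s))
      = (\<Sum>r\<in>{0..<int q}. \<Sum>t\<in>{0..<int q ^ w}. local_density q (Suc v) (int q * (r + int q * t)))"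
    using sum_residues_split[of "int q" "int q ^ w"] q0 Suc by simp
  also have "\<dots> = (\<Sum>r\<in>{0..<int q}. \<Sum>t\<in>{0..<int q ^ w}.
      1 + (if r = 0 then local_density q w t / real q else 0))"
    by (intro sum.cong refl summand)
  also have "\<dots> = (\<Sum>r\<in>{0..<int q}. real q ^ w + (if r = 0 then real q ^ w * mean_density q / real q else 0))"
    using full[OF Suc] by (intro sum.cong refl) (auto simp: sum.distrib sum_divide_distrib[symmetric])
  also have "\<dots> = real q * real q ^ w + real q ^ w * mean_density q / real q"
    using q0 by (simp add: sum.distrib)
  also have "\<dots> = real q ^ v * mean_density q"
    using q0 q2 unfolding Suc by (simp add: field_simps power2_eq_square)
  finally show ?thesis .
qed

text \<open>The class of \<open>r\<close> modulo \<open>q\<close> has average \<open>c (1 + \<chi>(r)/q)\<close>, also for \<open>r = 0\<close> since \<open>\<chi>(0) = 0\<close>. The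
  character sum vanishes, which leaves \<open>c\<close>.\<close>
lemma sum_local_density:
  assumes q: "prime q" "q \<noteq> 2"
  shows "(\<Sum>d\<in>{0..<int q ^ v}. local_density q v d) = real q ^ v * mean_density q"
proof (induction v rule: less_induct)
  case (less v)
  show ?case
  proof (cases v)
    case 0
    have "{0..<1::int} = {0}" by auto
    then show ?thesis using 0 by (simp add: local_density_0)
  next
    case (Suc w)
    have q0: "int q > 0" "real q > 0" using prime_gt_0_nat[OF q(1)] by auto
    have inner: "(\<Sum>t\<in>{0..<int q ^ w}. local_density q (Suc w) (r + int q * t))
        = real q ^ w * mean_density q * (1 + of_int (Legendre r (int q)) / real q)"
      if r: "r \<in> {0..<int q}" for r
    proof (cases "r = 0")
      case True
      have "(\<Sum>s\<in>{0..<int q ^ w}. local_density q (Suc w) (int q * s)) = real q ^ w * mean_density q"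
        using Suc by (intro sum_local_density_multiples q less.IH) auto
      then show ?thesis using True by (simp add: Legendre_def)
    next
      case False
      then have nd: "\<not> int q dvd r" using r by (auto dest: zdvd_imp_le)
      have "local_density q (Suc w) (r + int q * t)
          = mean_density q * (1 + of_int (Legendre r (int q)) / real q)" for t
      proof -
        have "\<not> int q dvd r + int q * t" using nd by (simp add: dvd_add_left_iff)
        moreover have "Legendre (r + int q * t) (int q) = Legendre r (int q)"
          by (rule Legendre_cong) (simp add: cong_def)
        ultimately show ?thesis using local_density_unit_eq_mean[OF q(1)] by simp
      qed
      then show ?thesis by simp
    qed
    have "(\<Sum>d\<in>{0..<int q ^ v}. local_density q v d)
        = (\<Sum>r\<in>{0..<int q}. \<Sum>t\<in>{0..<int q ^ w}. local_density q (Suc w) (r + int q * t))"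
      using sum_residues_split[of "int q" "int q ^ w"] q0 Suc by simp
    also have "\<dots> = (\<Sum>r\<in>{0..<int q}.
        real q ^ w * mean_density q * (1 + of_int (Legendre r (int q)) / real q))"
      by (intro sum.cong refl inner)
    also have "\<dots> = real q ^ w * mean_density q * (\<Sum>r\<in>{0..<int q}. 1 + of_int (Legendre r (int q)) / real q)"
      by (simp only: sum_distrib_left)
    also have "(\<Sum>r\<in>{0..<int q}. 1 + of_int (Legendre r (int q)) / real q) = real q"
      using sum_Legendre[of "int q"] q by (simp add: sum.distrib sum_divide_distrib[symmetric])
    finally show ?thesis using Suc by simp
  qed
qed

text \<open>If \<open>q\<close> divides \<open>r\<^sup>2 - 4 k\<close> then \<open>r\<close> is a unit modulo \<open>q\<close>, because \<open>4 k\<close> is one. The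
  discriminants of the lifts \<open>r + q t\<close> are then \<open>q g(t)\<close> with
  \<open>g(x) - g(y) = (2 r + q (x + y)) (x - y)\<close>, and the first factor is a unit; so \<open>g\<close> permutes the residues
  modulo \<open>q\<^sup>w\<close> and the average is the one over all multiples of \<open>q\<close>. Otherwise the density does not depend
  on \<open>t\<close>.\<close>
lemma sum_local_density_discriminant:
  fixes k r :: int
  assumes q: "prime q" "q \<noteq> 2" and k: "\<not> int q dvd k"
  shows "(\<Sum>t\<in>{0..<int q ^ w}. local_density q (Suc w) ((r + int q * t)\<^sup>2 - 4 * k))
    = real q ^ w * mean_density q * (1 + of_int (Legendre (r\<^sup>2 - 4 * k) (int q)) / real q)"
proof -
  have q0: "int q > 0" using prime_gt_0_nat[OF q(1)] by auto
  have pq: "prime (int q)" using q by simp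
  have expand: "(r + int q * t)\<^sup>2 - 4 * k = (r\<^sup>2 - 4 * k) + int q * (2 * r * t + int q * t\<^sup>2)" for t
    by (simp add: power2_eq_square algebra_simps)
  show ?thesis
  proof (cases "int q dvd r\<^sup>2 - 4 * k")
    case False
    have "local_density q (Suc w) ((r + int q * t)\<^sup>2 - 4 * k)
        = mean_density q * (1 + of_int (Legendre (r\<^sup>2 - 4 * k) (int q)) / real q)" for t
    proof -
      have "\<not> int q dvd (r + int q * t)\<^sup>2 - 4 * k"
        using False unfolding expand by (simp add: dvd_add_left_iff)
      moreover have "Legendre ((r + int q * t)\<^sup>2 - 4 * k) (int q) = Legendre (r\<^sup>2 - 4 * k) (int q)"
        unfolding expand by (rule Legendre_cong) (simp add: cong_def)
      ultimately show ?thesis using local_density_unit_eq_mean[OF q(1)] by simp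
    qed
    then show ?thesis by simp
  next
    case True
    then obtain d where d: "r\<^sup>2 - 4 * k = int q * d" by (auto elim: dvdE)
    have cop2: "coprime 2 (int q)" using q pq by (intro primes_coprime) auto
    then have cop4: "coprime 4 (int q)" using coprime_mult_left_iff[of 2 2 "int q"] by simp
    have nr: "\<not> int q dvd r"
    proof
      assume "int q dvd r"
      then have "int q dvd r\<^sup>2" by (simp add: power2_eq_square)
      from dvd_diff[OF this True] have "int q dvd r\<^sup>2 - (r\<^sup>2 - 4 * k)" .
      moreover have "r\<^sup>2 - (r\<^sup>2 - 4 * k) = 4 * k" by simp
      ultimately have "int q dvd 4 * k" by (simp only:)
      then show False using k cop4 by (metis coprime_commute coprime_dvd_mult_right_iff)
    qed
    define g where "g = (\<lambda>t. d + 2 * r * t + int q * t\<^sup>2)"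
    have D: "(r + int q * t)\<^sup>2 - 4 * k = int q * g t" for t
      unfolding expand d by (simp add: g_def algebra_simps)
    have "(\<Sum>t\<in>{0..<int q ^ w}. local_density q (Suc w) (int q * g t))
        = (\<Sum>t\<in>{0..<int q ^ w}. local_density q (Suc w) (int q * t))"
    proof (rule sum_residues_reindex[where g = g and f = "\<lambda>t. local_density q (Suc w) (int q * t)"])
      show "int q ^ w > 0" using q0 by simp
    next
      fix x y assume "[x = y] (mod int q ^ w)"
      then have "int q * int q ^ w dvd int q * (x - y)"
        by (simp add: cong_iff_dvd_diff)
      then have "[int q * x = int q * y] (mod int q ^ Suc w)"
        by (simp add: cong_iff_dvd_diff algebra_simps)
      then show "local_density q (Suc w) (int q * x) = local_density q (Suc w) (int q * y)"
        by (rule local_density_cong[OF q(1)])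
    next
      fix x y assume "[g x = g y] (mod int q ^ w)"
      moreover have "g x - g y = (2 * r + int q * (x + y)) * (x - y)"
        by (simp add: g_def power2_eq_square algebra_simps)
      ultimately have dvd: "int q ^ w dvd (2 * r + int q * (x + y)) * (x - y)"
        by (simp add: cong_iff_dvd_diff)
      have "\<not> int q dvd 2 * r"
        using nr cop2 by (metis coprime_commute coprime_dvd_mult_right_iff)
      then have "\<not> int q dvd 2 * r + int q * (x + y)" by (simp add: dvd_add_left_iff)
      with pq have "coprime (int q) (2 * r + int q * (x + y))" by (rule prime_imp_coprime)
      then have "coprime (int q ^ w) (2 * r + int q * (x + y))" by simp
      then show "[x = y] (mod int q ^ w)"
        using dvd by (simp add: cong_iff_dvd_diff coprime_dvd_mult_right_iff)
    qed
    also have "\<dots> = real q ^ w * mean_density q"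
      using q by (intro sum_local_density_multiples sum_local_density)
    finally show ?thesis unfolding D using d by (simp add: Legendre_def cong_0_iff)
  qed
qed

text \<open>The excluded class \<open>u = k + 1\<close> has discriminant \<open>(k + 1)\<^sup>2 - 4 k = (k - 1)\<^sup>2\<close>, whose Legendre symbol
  is \<open>0\<close> or \<open>1\<close> according to whether \<open>q\<close> divides \<open>k - 1\<close>.\<close>
lemma sum_local_density_trace_condition:
  fixes k :: int
  assumes q: "prime q" "q \<noteq> 2" and k: "\<not> int q dvd k" and v: "v > 0"
  shows "(\<Sum>u\<in>{0..<int q ^ v}. if int q dvd k + 1 - u then 0 else local_density q v (u\<^sup>2 - 4 * k))
    = real q ^ v * (if int q dvd k - 1 then ((real q)\<^sup>2 - real q - 1) / ((real q)\<^sup>2 - 1)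
                    else (real q - 2) / (real q - 1))"
proof -
  obtain w where w: "v = Suc w" using v by (cases v) auto
  have q0: "int q > 0" and q1: "real q > 1" using prime_gt_1_nat[OF q(1)] by auto
  define h where "h = (\<lambda>r. 1 + of_int (Legendre (r\<^sup>2 - 4 * k) (int q)) / real q)"
  define a where "a = (k + 1) mod int q"
  have a: "a \<in> {0..<int q}" using q0 by (simp add: a_def)
  have dvd: "int q dvd k + 1 - (r + int q * t) \<longleftrightarrow> r = a" if "r \<in> {0..<int q}" for r t
  proof -
    have "int q dvd k + 1 - (r + int q * t) \<longleftrightarrow> [k + 1 = r + int q * t] (mod int q)"
      by (simp add: cong_iff_dvd_diff)
    also have "\<dots> \<longleftrightarrow> r = a" using that by (auto simp: cong_def a_def)
    finally show ?thesis .
  qed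
  have ha: "h a = 1 + (if int q dvd k - 1 then 0 else 1) / real q"
  proof -
    have "[a\<^sup>2 = (k + 1)\<^sup>2] (mod int q)" by (simp add: a_def cong_def power_mod)
    then have "[a\<^sup>2 - 4 * k = (k + 1)\<^sup>2 - 4 * k] (mod int q)" by (intro cong_diff cong_refl)
    also have "(k + 1)\<^sup>2 - 4 * k = (k - 1)\<^sup>2" by (simp add: power2_eq_square algebra_simps)
    finally have "Legendre (a\<^sup>2 - 4 * k) (int q) = Legendre ((k - 1)\<^sup>2) (int q)" by (rule Legendre_cong)
    moreover have "QuadRes (int q) ((k - 1)\<^sup>2)" unfolding QuadRes_def using cong_refl by blast
    moreover have "[(k - 1)\<^sup>2 = 0] (mod int q) \<longleftrightarrow> int q dvd k - 1"
      using q by (simp add: cong_0_iff prime_dvd_power_iff)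
    ultimately show ?thesis by (simp add: h_def Legendre_def)
  qed
  have sumh: "(\<Sum>r\<in>{0..<int q}. h r) = real q - 1 / real q"
    using sum_Legendre_discriminant[of "int q" k] q k
    by (simp add: h_def sum.distrib sum_divide_distrib[symmetric])
  have "(\<Sum>u\<in>{0..<int q ^ v}. if int q dvd k + 1 - u then 0 else local_density q v (u\<^sup>2 - 4 * k))
      = (\<Sum>r\<in>{0..<int q}. \<Sum>t\<in>{0..<int q ^ w}. if int q dvd k + 1 - (r + int q * t) then 0
           else local_density q v ((r + int q * t)\<^sup>2 - 4 * k))"
    using sum_residues_split[of "int q" "int q ^ w"] q0 w by simp
  also have "\<dots> = (\<Sum>r\<in>{0..<int q}. if r = a then 0 else real q ^ w * mean_density q * h r)"
    by (intro sum.cong refl)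
      (simp add: dvd w sum_local_density_discriminant[OF q k] h_def)
  also have "\<dots> = (\<Sum>r\<in>{0..<int q}. real q ^ w * mean_density q * h r
      - (if r = a then real q ^ w * mean_density q * h r else 0))"
    by (intro sum.cong) auto
  also have "\<dots> = real q ^ w * mean_density q * ((\<Sum>r\<in>{0..<int q}. h r) - h a)"
    using a by (simp add: sum_subtractf sum_distrib_left sum_distrib_right right_diff_distrib)
  also have "\<dots> = real q ^ v * (if int q dvd k - 1 then ((real q)\<^sup>2 - real q - 1) / ((real q)\<^sup>2 - 1)
                    else (real q - 2) / (real q - 1))"
  proof -
    have alg: "x\<^sup>2 / (x\<^sup>2 - 1) * (x - 1 / x - (1 + 0 / x)) = x * ((x\<^sup>2 - x - 1) / (x\<^sup>2 - 1))"
      "x\<^sup>2 / (x\<^sup>2 - 1) * (x - 1 / x - (1 + 1 / x)) = x * ((x - 2) / (x - 1))" if "x > 1" for x :: real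
    proof -
      have nz: "x - 1 \<noteq> 0" "x + 1 \<noteq> 0" "x \<noteq> 0" using that by auto
      have sq: "x\<^sup>2 - 1 = (x - 1) * (x + 1)" by (simp add: power2_eq_square algebra_simps)
      show "x\<^sup>2 / (x\<^sup>2 - 1) * (x - 1 / x - (1 + 0 / x)) = x * ((x\<^sup>2 - x - 1) / (x\<^sup>2 - 1))"
        unfolding sq using nz by (simp add: divide_simps) (simp add: power2_eq_square algebra_simps)
      show "x\<^sup>2 / (x\<^sup>2 - 1) * (x - 1 / x - (1 + 1 / x)) = x * ((x - 2) / (x - 1))"
        unfolding sq using nz by (simp add: divide_simps) (simp add: power2_eq_square algebra_simps)
    qed
    show ?thesis
      unfolding sumh ha w mult.assoc[of "real q ^ w"]
      by (cases "int q dvd k - 1", simp_all only: if_True if_False alg[OF q1])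
        (simp_all only: power_Suc mult.assoc mult.left_commute)
  qed
  finally show ?thesis .
qed

section \<open>The sum over traces as a product\<close>

lemma kronecker_odd_prime:
  assumes "prime q" "q \<noteq> 2"
  shows "kronecker a (int q) = Legendre a (int q)"
proof -
  have "prime (int q)" using assms by simp
  then have "prime_factors (int q) = {int q}" "multiplicity (int q) (int q) = 1"
    by (simp_all add: prime_prime_factors)
  then show ?thesis using assms prime_gt_0_nat[of q] by (simp add: kronecker_def kronecker_prime_def)
qed

lemma nat_ceiling_half: "nat \<lceil>real m / 2\<rceil> = (m + 1) div 2"
  by linarith

lemma nu_eq_0_iff:
  assumes "prime q"
  shows "nu k u q = 0 \<longleftrightarrow> \<not> int q dvd u\<^sup>2 - 4 * int k"
  using assms by (auto simp: nu_def val_def zero_enat_def prime_elem_multiplicity_eq_zero_iff)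

lemma eta_factor_times_Q:
  assumes q: "prime q" "q \<noteq> 2" and n: "n > 0" "q dvd n"
  shows "inverse (1 - of_int (eta k u q) / real q) * Q n k u q
    = local_density q (multiplicity q n) (u\<^sup>2 - 4 * int k)"
proof -
  define D where "D = u\<^sup>2 - 4 * int k"
  have v: "multiplicity q n > 0"
    using q n by (simp add: prime_multiplicity_gt_zero_iff)
  have eta: "eta k u q = Legendre D (int q)"
    using kronecker_odd_prime[OF q] by (simp add: eta_def D_def)
  have psi: "psi k u q = Legendre (D div int q ^ multiplicity (int q) D) (int q)" if "D \<noteq> 0"
    using kronecker_odd_prime[OF q] that by (simp add: psi_def nu_def val_def D_def)
  show ?thesis
  proof (cases "int q dvd D")
    case False
    then have "Q n k u q = 1" using q nu_eq_0_iff by (simp add: Q_def Let_def D_def)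
    moreover have "inverse (1 - of_int (eta k u q) / real q) = real q / (real q - of_int (eta k u q))"
      using prime_gt_0_nat[OF q(1)] by (simp add: field_simps)
    ultimately show ?thesis
      using v False by (simp add: local_density_unit eta flip: D_def)
  next
    case True
    have "nu k u q \<noteq> 0" using True q nu_eq_0_iff by (simp add: D_def)
    moreover have "nu k u q < enat (multiplicity q n) \<longleftrightarrow> D \<noteq> 0 \<and> multiplicity (int q) D < multiplicity q n"
      by (simp add: nu_def val_def D_def)
    moreover have "the_enat (nu k u q) = multiplicity (int q) D" if "D \<noteq> 0"
      using that by (simp add: nu_def val_def D_def)
    ultimately have "Q n k u q = local_density q (multiplicity q n) D"
      using psi unfolding Q_def local_density_def Let_def geometric_def nat_ceiling_half by auto
    moreover have "eta k u q = 0" using True by (simp add: eta Legendre_def cong_0_iff)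
    ultimately show ?thesis by (simp add: D_def)
  qed
qed

text \<open>The product of the \<open>Q\<close> factors skips the odd primes dividing \<open>u (u - 2)\<close>. Those factors are \<open>1\<close> anyway:
  modulo \<open>q\<close> the discriminant is \<open>- 4 k\<close> if \<open>q\<close> divides \<open>u\<close>, and it is \<open>- 4 (k + 1 - u)\<close> if
  \<open>q\<close> divides \<open>u - 2\<close>; both are units by hypothesis.\<close>
lemma Q_eq_1_if_dvd:
  assumes q: "prime q" "q \<noteq> 2" and k: "\<not> q dvd k" and ndg: "\<not> int q dvd int k + 1 - u"
    and d: "int q dvd 2 * u * (u - 2)"
  shows "Q n k u q = 1"
proof -
  have pq: "prime (int q)" using q by simp
  have nd2: "\<not> int q dvd 2" and nd4: "\<not> int q dvd 4"
  proof -
    show "\<not> int q dvd 2" using pq q(2) primes_dvd_imp_eq[of "int q" 2] by auto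
    then show "\<not> int q dvd 4" using pq prime_dvd_mult_iff[of "int q" 2 2] by simp
  qed
  have ndk: "\<not> int q dvd int k" using k by simp
  have "int q dvd u \<or> int q dvd u - 2" using d nd2 pq by (simp add: prime_dvd_mult_iff)
  then have "\<not> int q dvd u\<^sup>2 - 4 * int k"
  proof
    assume "int q dvd u"
    then have du: "int q dvd u\<^sup>2" by (simp add: power2_eq_square)
    show ?thesis
    proof
      assume "int q dvd u\<^sup>2 - 4 * int k"
      from dvd_diff[OF du this] have "int q dvd 4 * int k" by simp
      then show False using pq nd4 ndk prime_dvd_mult_iff by blast
    qed
  next
    assume du: "int q dvd u - 2"
    show ?thesis
    proof
      assume "int q dvd u\<^sup>2 - 4 * int k"
      moreover have "4 * (int k + 1 - u) = (u - 2) * (u - 2) - (u\<^sup>2 - 4 * int k)"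
        by (simp add: power2_eq_square algebra_simps)
      ultimately have "int q dvd 4 * (int k + 1 - u)"
        using du by (metis dvd_diff dvd_mult)
      then show False using pq nd4 ndg prime_dvd_mult_iff by blast
    qed
  qed
  then have "nu k u q = 0" using q nu_eq_0_iff by simp
  then show ?thesis by (simp add: Q_def Let_def)
qed

text \<open>The coprimality condition on \<open>u\<close> is absorbed into the weights, prime by prime, so that the
  sum over \<open>u\<close> becomes unrestricted and the Chinese remainder theorem applies.\<close>
definition local_weight :: "nat \<Rightarrow> nat \<Rightarrow> nat \<Rightarrow> int \<Rightarrow> real" where
  "local_weight n k q u =
     (if int q dvd int k + 1 - u then 0
      else if q = 2 then 1 else local_density q (multiplicity q n) (u\<^sup>2 - 4 * int k))"

lemma S_eq_sum_local_weights:
  assumes n: "n > 0" and cop: "coprime n k"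
  shows "S n k = (\<Sum>u\<in>{0..<int n}. \<Prod>q\<in>prime_factors n. local_weight n k q u)"
proof -
  have pf: "prime_factors n = {q. prime q \<and> q dvd n}"
    using n by (auto simp: prime_factors_dvd)
  have fin: "finite {q. prime q \<and> q dvd n}" unfolding pf[symmetric] by simp
  have gcd_iff: "gcd (int n) (int k + 1 - u) = 1 \<longleftrightarrow> (\<forall>q. prime q \<and> q dvd n \<longrightarrow> \<not> int q dvd int k + 1 - u)" for u
  proof
    assume g: "gcd (int n) (int k + 1 - u) = 1"
    show "\<forall>q. prime q \<and> q dvd n \<longrightarrow> \<not> int q dvd int k + 1 - u"
    proof (intro allI impI notI)
      fix q assume "prime q \<and> q dvd n" "int q dvd int k + 1 - u"
      then have "int q dvd gcd (int n) (int k + 1 - u)" "q \<noteq> 1" by auto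
      then show False using g by simp
    qed
  next
    assume nd: "\<forall>q. prime q \<and> q dvd n \<longrightarrow> \<not> int q dvd int k + 1 - u"
    have "coprime (int n) (int k + 1 - u)"
    proof (rule ccontr)
      assume "\<not> coprime (int n) (int k + 1 - u)"
      then have "gcd (int n) (int k + 1 - u) \<noteq> 1" by (simp add: coprime_iff_gcd_eq_1)
      then have "nat (gcd (int n) (int k + 1 - u)) \<noteq> 1" by auto
      then obtain q where q: "prime q" "q dvd nat (gcd (int n) (int k + 1 - u))"
        using prime_factor_nat by blast
      then have "int q dvd int (nat (gcd (int n) (int k + 1 - u)))" by (simp only: int_dvd_int_iff)
      then have "int q dvd gcd (int n) (int k + 1 - u)" by simp
      then have "int q dvd int n" "int q dvd int k + 1 - u" using dvd_trans by blast+
      then show False using nd q(1) by simp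
    qed
    then show "gcd (int n) (int k + 1 - u) = 1" by simp
  qed
  have summand: "(\<Prod>q\<in>{q. prime q \<and> q dvd n \<and> q \<noteq> 2}. inverse (1 - of_int (eta k u q) / real q)) *
        (\<Prod>q\<in>{q. prime q \<and> q dvd n \<and> \<not> int q dvd 2 * u * (u - 2)}. Q n k u q)
      = (\<Prod>q\<in>prime_factors n. local_weight n k q u)"
    if g: "gcd (int n) (int k + 1 - u) = 1" for u
  proof -
    have "(\<Prod>q\<in>{q. prime q \<and> q dvd n \<and> \<not> int q dvd 2 * u * (u - 2)}. Q n k u q)
        = (\<Prod>q\<in>{q. prime q \<and> q dvd n \<and> q \<noteq> 2}. Q n k u q)"
    proof (rule prod.mono_neutral_left)
      show "finite {q. prime q \<and> q dvd n \<and> q \<noteq> 2}"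
        using fin by (rule rev_finite_subset) auto
      show "{q. prime q \<and> q dvd n \<and> \<not> int q dvd 2 * u * (u - 2)} \<subseteq> {q. prime q \<and> q dvd n \<and> q \<noteq> 2}"
        by auto
      show "\<forall>q\<in>{q. prime q \<and> q dvd n \<and> q \<noteq> 2} - {q. prime q \<and> q dvd n \<and> \<not> int q dvd 2 * u * (u - 2)}. Q n k u q = 1"
      proof
        fix q assume "q \<in> {q. prime q \<and> q dvd n \<and> q \<noteq> 2} - {q. prime q \<and> q dvd n \<and> \<not> int q dvd 2 * u * (u - 2)}"
        then have q: "prime q" "q dvd n" "q \<noteq> 2" and d: "int q dvd 2 * u * (u - 2)" by auto
        have "\<not> q dvd k"
        proof
          assume "q dvd k"
          then have "q dvd 1" using q cop by (meson coprime_common_divisor)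
          then show False using q by auto
        qed
        moreover have "\<not> int q dvd int k + 1 - u"
          using iffD1[OF gcd_iff g] q by blast
        ultimately show "Q n k u q = 1" by (rule Q_eq_1_if_dvd[OF q(1,3) _ _ d])
      qed
    qed
    then have "(\<Prod>q\<in>{q. prime q \<and> q dvd n \<and> q \<noteq> 2}. inverse (1 - of_int (eta k u q) / real q)) *
        (\<Prod>q\<in>{q. prime q \<and> q dvd n \<and> \<not> int q dvd 2 * u * (u - 2)}. Q n k u q)
      = (\<Prod>q\<in>{q. prime q \<and> q dvd n \<and> q \<noteq> 2}. inverse (1 - of_int (eta k u q) / real q) * Q n k u q)"
      by (simp add: prod.distrib)
    also have "\<dots> = (\<Prod>q\<in>{q. prime q \<and> q dvd n \<and> q \<noteq> 2}. local_weight n k q u)"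
    proof (intro prod.cong refl)
      fix q assume "q \<in> {q. prime q \<and> q dvd n \<and> q \<noteq> 2}"
      then show "inverse (1 - of_int (eta k u q) / real q) * Q n k u q = local_weight n k q u"
        using gcd_iff[of u] g n eta_factor_times_Q by (simp add: local_weight_def)
    qed
    also have "\<dots> = (\<Prod>q\<in>prime_factors n. local_weight n k q u)"
    proof (rule prod.mono_neutral_left)
      show "\<forall>q\<in>prime_factors n - {q. prime q \<and> q dvd n \<and> q \<noteq> 2}. local_weight n k q u = 1"
        using gcd_iff[of u] g by (auto simp: pf local_weight_def)
    qed (use fin in \<open>auto simp: pf\<close>)
    finally show ?thesis .
  qed
  have zero: "(\<Prod>q\<in>prime_factors n. local_weight n k q u) = 0"
    if "gcd (int n) (int k + 1 - u) \<noteq> 1" for u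
  proof -
    have "\<exists>q. prime q \<and> q dvd n \<and> int q dvd int k + 1 - u"
      using that gcd_iff[of u] by blast
    then obtain q where "q \<in> prime_factors n" "int q dvd int k + 1 - u"
      unfolding pf by blast
    moreover from this have "local_weight n k q u = 0" by (simp add: local_weight_def)
    ultimately show ?thesis by (intro prod_zero) auto
  qed
  have "S n k = (\<Sum>u\<in>{u\<in>{0..<int n}. gcd (int n) (int k + 1 - u) = 1}. \<Prod>q\<in>prime_factors n. local_weight n k q u)"
    unfolding S_def by (intro sum.cong refl summand) auto
  also have "\<dots> = (\<Sum>u\<in>{0..<int n}. \<Prod>q\<in>prime_factors n. local_weight n k q u)"
  proof (rule sum.mono_neutral_left)
    show "\<forall>u\<in>{0..<int n} - {u \<in> {0..<int n}. gcd (int n) (int k + 1 - u) = 1}.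
        (\<Prod>q\<in>prime_factors n. local_weight n k q u) = 0"
      using zero by blast
  qed auto
  finally show ?thesis .
qed

text \<open>The average of the local weight at \<open>q\<close> over \<open>u\<close> modulo \<open>q\<^sup>v\<close>, for primes \<open>q\<close> not dividing \<open>k\<close>.
  It is the same for all \<open>v > 0\<close>.\<close>
definition density_factor :: "nat \<Rightarrow> nat \<Rightarrow> real" where
  "density_factor k q =
     (if q = 2 then 1 / 2
      else if int q dvd int k - 1 then ((real q)\<^sup>2 - real q - 1) / ((real q)\<^sup>2 - 1)
      else (real q - 2) / (real q - 1))"

lemma sum_local_weight:
  assumes n: "n > 0" and cop: "coprime n k" and q: "prime q" "q dvd n"
  shows "(\<Sum>u\<in>{0..<int q ^ multiplicity q n}. local_weight n k q u)
    = real q ^ multiplicity q n * density_factor k q"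
proof -
  have v: "multiplicity q n > 0" using n q by (simp add: prime_multiplicity_gt_zero_iff)
  have ndk: "\<not> q dvd k"
  proof
    assume "q dvd k"
    then have "q dvd 1" using q cop by (meson coprime_common_divisor)
    then show False using q by auto
  qed
  show ?thesis
  proof (cases "q = 2")
    case False
    have "\<not> int q dvd int k" using ndk by simp
    from sum_local_density_trace_condition[OF q(1) False this v] show ?thesis
      using False by (simp add: local_weight_def density_factor_def cong: if_cong)
  next
    case True
    obtain w where w: "multiplicity q n = Suc w" using v by (cases "multiplicity q n") auto
    have two: "{0..<2::int} = {0, 1}" by auto
    \<comment> \<open>As \<open>k\<close> is odd, the class \<open>r = 0\<close> modulo \<open>2\<close> is excluded and \<open>r = 1\<close> has weight \<open>1\<close>.\<close>
    have odd: "odd k" using ndk True by simp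
    have "(\<Sum>u\<in>{0..<int q ^ multiplicity q n}. local_weight n k q u)
        = (\<Sum>r\<in>{0..<2}. \<Sum>t\<in>{0..<2 ^ w}. local_weight n k q (r + 2 * t))"
      using sum_residues_split[of 2 "2 ^ w"] True w by simp
    also have "\<dots> = 2 ^ w"
      using True odd by (simp add: two local_weight_def)
    finally show ?thesis using True w by (simp add: density_factor_def)
  qed
qed

lemma S_eq_prod:
  assumes n: "n > 0" and cop: "coprime n k"
  shows "S n k = real n * (\<Prod>q\<in>prime_factors n. density_factor k q)"
proof -
  have fact: "n = (\<Prod>q\<in>prime_factors n. q ^ multiplicity q n)"
    using n by (simp add: prod_prime_factors)
  have factI: "int n = (\<Prod>q\<in>prime_factors n. int q ^ multiplicity q n)"
    by (subst fact) (simp add: of_nat_prod)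
  have factR: "real n = (\<Prod>q\<in>prime_factors n. real q ^ multiplicity q n)"
    by (subst fact) (simp add: of_nat_prod)
  have "S n k = (\<Sum>u\<in>{0..<\<Prod>q\<in>prime_factors n. int q ^ multiplicity q n}.
      \<Prod>q\<in>prime_factors n. local_weight n k q u)"
    using S_eq_sum_local_weights[OF n cop] factI by simp
  also have "\<dots> = (\<Prod>q\<in>prime_factors n. \<Sum>u\<in>{0..<int q ^ multiplicity q n}. local_weight n k q u)"
  proof (rule sum_prod_residues)
    fix q r assume "q \<in> prime_factors n" "r \<in> prime_factors n" "q \<noteq> r"
    then have "coprime (int q) (int r)" by (auto intro: primes_coprime)
    then show "coprime (int q ^ multiplicity q n) (int r ^ multiplicity r n)" by simp
  next
    fix q x y assume q: "q \<in> prime_factors n" and xy: "[x = y] (mod int q ^ multiplicity q n)"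
    have "int q dvd int q ^ multiplicity q n"
      using q n by (intro dvd_power) (auto simp: prime_multiplicity_gt_zero_iff prime_factors_dvd)
    then have "[x = y] (mod int q)" using xy cong_dvd_modulus by blast
    then have "[int k + 1 - x = int k + 1 - y] (mod int q)" by (intro cong_diff cong_refl)
    then have "int q dvd int k + 1 - x \<longleftrightarrow> int q dvd int k + 1 - y" by (rule cong_dvd_iff)
    moreover have "[x\<^sup>2 - 4 * int k = y\<^sup>2 - 4 * int k] (mod int q ^ multiplicity q n)"
      using xy by (intro cong_diff cong_pow cong_refl)
    then have "local_density q (multiplicity q n) (x\<^sup>2 - 4 * int k)
        = local_density q (multiplicity q n) (y\<^sup>2 - 4 * int k)"
      using q by (intro local_density_cong) auto
    ultimately show "local_weight n k q x = local_weight n k q y" by (simp add: local_weight_def)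
  next
    fix q assume "q \<in> prime_factors n"
    then show "int q ^ multiplicity q n > 0" by (simp add: in_prime_factors_iff prime_gt_0_nat)
  qed simp
  also have "\<dots> = (\<Prod>q\<in>prime_factors n. real q ^ multiplicity q n * density_factor k q)"
    using n cop by (intro prod.cong refl sum_local_weight) auto
  finally show ?thesis by (simp add: prod.distrib factR)
qed

section \<open>The infinite product\<close>

text \<open>The product of these factors over all primes is the constant in Koblitz's conjecture.\<close>
definition koblitz_factor :: "nat \<Rightarrow> real" where
  "koblitz_factor q = 1 - ((real q)\<^sup>2 - real q - 1) / ((real q - 1) ^ 3 * (real q + 1))"

lemma koblitz_factor_eq:
  assumes "q \<ge> 2"
  shows "koblitz_factor q = (real q * (real q ^ 3 - 2 * (real q)\<^sup>2 - real q + 3)) / ((real q + 1) * (real q - 1) ^ 3)"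
proof -
  have "(real q - 1) ^ 3 * (real q + 1) \<noteq> 0" using assms by auto
  then have "koblitz_factor q = ((real q - 1) ^ 3 * (real q + 1) - ((real q)\<^sup>2 - real q - 1)) / ((real q - 1) ^ 3 * (real q + 1))"
    by (simp add: koblitz_factor_def diff_divide_distrib)
  also have "(real q - 1) ^ 3 * (real q + 1) - ((real q)\<^sup>2 - real q - 1)
      = real q * (real q ^ 3 - 2 * (real q)\<^sup>2 - real q + 3)"
    by (simp add: power2_eq_square power3_eq_cube algebra_simps)
  finally show ?thesis by (simp add: mult.commute)
qed

text \<open>Convergence: \<open>q\<^sup>2 - q - 1 \<le> q\<^sup>2 - 1 = (q - 1) (q + 1)\<close> leaves the bound \<open>1 / (q - 1)\<^sup>2\<close>, and
  \<open>q \<le> 2 (q - 1)\<close>.\<close>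
lemma norm_koblitz_factor_minus_1:
  assumes "q \<ge> 2"
  shows "norm (koblitz_factor q - 1) \<le> 4 * inverse ((real q)\<^sup>2)"
proof -
  define x where "x = real q"
  have x: "x \<ge> 2" using assms by (simp add: x_def)
  have pos: "(x - 1) ^ 3 * (x + 1) > 0" using x by auto
  have "x * 2 \<le> x * x" using x by (intro mult_left_mono) auto
  then have num: "0 \<le> x\<^sup>2 - x - 1" using x unfolding power2_eq_square by linarith
  \<comment> \<open>The product is \<open>4 (x - 1)\<^sup>2 - x\<^sup>2\<close>.\<close>
  have "(x - 2) * (3 * x - 2) \<ge> 0" using x by (intro mult_nonneg_nonneg) auto
  then have sq: "x\<^sup>2 \<le> 4 * (x - 1)\<^sup>2" by (simp add: power2_eq_square algebra_simps)
  have "(x\<^sup>2 - x - 1) * x\<^sup>2 \<le> (x\<^sup>2 - 1) * (4 * (x - 1)\<^sup>2)"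
    using num sq x by (intro mult_mono) auto
  also have "\<dots> = 4 * ((x - 1) ^ 3 * (x + 1))"
    by (simp add: power2_eq_square power3_eq_cube algebra_simps)
  finally have "(x\<^sup>2 - x - 1) / ((x - 1) ^ 3 * (x + 1)) \<le> 4 / x\<^sup>2"
    using pos x by (simp add: divide_simps)
  moreover have "norm (koblitz_factor q - 1) = (x\<^sup>2 - x - 1) / ((x - 1) ^ 3 * (x + 1))"
    using num pos by (simp add: koblitz_factor_def x_def[symmetric])
  ultimately show ?thesis by (simp add: x_def divide_inverse)
qed

lemma convergent_prod_koblitz:
  "convergent_prod (\<lambda>q. if prime q \<and> P q then koblitz_factor q else 1)"
proof -
  have "summable (\<lambda>q. norm ((if prime q \<and> P q then koblitz_factor q else 1) - 1))"
  proof (rule summable_comparison_test)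
    show "summable (\<lambda>q. 4 * inverse ((real q)\<^sup>2))"
      by (intro summable_mult inverse_power_summable) auto
    show "\<exists>N. \<forall>q\<ge>N. norm (norm ((if prime q \<and> P q then koblitz_factor q else 1) - 1)) \<le> 4 * inverse ((real q)\<^sup>2)"
      using norm_koblitz_factor_minus_1 prime_ge_2_nat by (auto intro!: exI[of _ 0])
  qed
  then have "abs_convergent_prod (\<lambda>q. if prime q \<and> P q then koblitz_factor q else 1)"
    by (rule summable_imp_abs_convergent_prod)
  then show ?thesis by (rule abs_convergent_prod_imp_convergent_prod)
qed

text \<open>For odd \<open>n\<close> the two products differ exactly in the factor at \<open>2\<close>. That factor can be pulled out because
  both products converge.\<close>
lemma prime_prod_koblitz_split_2:
  "prime_prod (\<lambda>q. \<not> q dvd n) koblitz_factor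
    = (if even n then 1 else 2 / 3) * prime_prod (\<lambda>q. \<not> q dvd 2 * n) koblitz_factor"
proof -
  have dvd: "q dvd 2 * n \<longleftrightarrow> q = 2 \<or> q dvd n" if "prime q" for q
    using that primes_dvd_imp_eq[OF that two_is_prime_nat] by (auto simp: prime_dvd_mult_iff)
  show ?thesis
  proof (cases "even n")
    case True
    then have "prime q \<and> \<not> q dvd n \<longleftrightarrow> prime q \<and> \<not> q dvd 2 * n" for q using dvd by auto
    then show ?thesis using True by (simp add: prime_prod_def)
  next
    case False
    have one: "(\<lambda>q. if q = 2 then koblitz_factor q else 1) has_prod koblitz_factor 2"
      by (rule has_prod_single)
    have "(\<lambda>q. if prime q \<and> \<not> q dvd n then koblitz_factor q else 1)
        = (\<lambda>q. (if q = 2 then koblitz_factor q else 1) * (if prime q \<and> \<not> q dvd 2 * n then koblitz_factor q else 1))"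
      using False dvd by fastforce
    then have "prime_prod (\<lambda>q. \<not> q dvd n) koblitz_factor
        = prodinf (\<lambda>q. if q = 2 then koblitz_factor q else 1) * prime_prod (\<lambda>q. \<not> q dvd 2 * n) koblitz_factor"
      unfolding prime_prod_def
      using prodinf_mult[OF has_prod_iff[THEN iffD1, OF one, THEN conjunct1] convergent_prod_koblitz[of "\<lambda>q. \<not> q dvd 2 * n"]]
      by simp
    also have "prodinf (\<lambda>q. if q = 2 then koblitz_factor q else 1) = 2 / 3"
      using has_prod_iff[THEN iffD1, OF one] by (simp add: koblitz_factor_def)
    finally show ?thesis using False by simp
  qed
qed

section \<open>Comparison of the Euler factors\<close>

lemma density_factor_times:
  assumes "prime q" "q \<noteq> 2"
  shows "density_factor k q * (real q / (real q - 1))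
    = (if int q dvd int k - 1 then 1 - 1 / ((real q - 1)\<^sup>2 * (real q + 1)) else 1 - 1 / (real q - 1)\<^sup>2)"
proof -
  define x where "x = real q"
  have nz: "x - 1 \<noteq> 0" "x + 1 \<noteq> 0"
    using prime_gt_1_nat[OF assms(1)] by (auto simp: x_def)
  have sq: "x\<^sup>2 - 1 = (x - 1) * (x + 1)" by (simp add: power2_eq_square algebra_simps)
  have "(x\<^sup>2 - x - 1) / (x\<^sup>2 - 1) * (x / (x - 1)) = 1 - 1 / ((x - 1)\<^sup>2 * (x + 1))"
    unfolding sq using nz by (simp add: divide_simps) (simp add: power2_eq_square algebra_simps)
  moreover have "(x - 2) / (x - 1) * (x / (x - 1)) = 1 - 1 / (x - 1)\<^sup>2"
    using nz by (simp add: divide_simps) (simp add: power2_eq_square algebra_simps)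
  ultimately show ?thesis using assms(2) by (simp only: density_factor_def x_def if_False split: if_splits) simp
qed

theorem proposition8p7:
  fixes n k :: nat
  assumes "n > 0" and "k > 0" and "coprime n k"
  shows "C n k = 2 * C_prime n k"
proof -
  define A where "A = {q. prime q \<and> q dvd n \<and> q \<noteq> 2}"
  define e where "e = (\<lambda>q. if int q dvd int k - 1 then 1 - 1 / ((real q - 1)\<^sup>2 * (real q + 1))
                           else 1 - 1 / (real q - 1)\<^sup>2)"
  define T where "T = prime_prod (\<lambda>q. \<not> q dvd 2 * n) koblitz_factor"
  have pf: "prime_factors n = {q. prime q \<and> q dvd n}"
    using assms(1) by (auto simp: prime_factors_dvd)
  have fin: "finite {q. prime q \<and> q dvd n}" unfolding pf[symmetric] by simp
  have finA: "finite A" using fin by (rule rev_finite_subset) (auto simp: A_def)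
  have split: "(\<Prod>q\<in>prime_factors n. f q) = (if even n then f 2 else 1) * (\<Prod>q\<in>A. f q)" for f :: "nat \<Rightarrow> real"
  proof (cases "even n")
    case True
    then have "prime_factors n = insert 2 A" by (auto simp: pf A_def)
    then show ?thesis using True finA by (simp add: A_def)
  next
    case False
    then have "prime_factors n = A" by (auto simp: pf A_def)
    then show ?thesis using False by simp
  qed
  have e2: "e 2 = 2 / 3" if "even n"
  proof -
    have "odd k" using that assms(3) by (meson coprime_common_divisor odd_one)
    then show ?thesis by (simp add: e_def)
  qed
  have gcd2: "gcd 2 n = (if even n then 2 else 1)"
  proof (cases "even n")
    case True
    then show ?thesis using gcd_nat.absorb1[of 2 n] by simp
  next
    case False
    then have "coprime 2 n" by simp
    then show ?thesis using False by (simp only: coprime_iff_gcd_eq_1 if_False)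
  qed
  have tail: "prime_prod (\<lambda>q. \<not> q dvd 2 * n)
       (\<lambda>q. (real q * (real q ^ 3 - 2 * (real q)\<^sup>2 - real q + 3)) / ((real q + 1) * (real q - 1) ^ 3)) = T"
    unfolding T_def prime_prod_def by (intro prodinf_cong) (simp add: koblitz_factor_eq prime_ge_2_nat)
  have "(\<Prod>q\<in>A. density_factor k q) * (\<Prod>q\<in>A. real q / (real q - 1)) = (\<Prod>q\<in>A. e q)"
    unfolding prod.distrib[symmetric] e_def
    by (intro prod.cong refl density_factor_times) (auto simp: A_def)
  moreover have "S n k / real n = (if even n then 1 / 2 else 1) * (\<Prod>q\<in>A. density_factor k q)"
    using assms by (simp add: S_eq_prod split density_factor_def)
  ultimately have lhs: "C n k = 4 / (3 * real (totient n)) * (\<Prod>q\<in>A. e q) * T"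
    unfolding C_def tail A_def[symmetric] using gcd2 by (simp add: field_simps)
  have "(\<Prod>q\<in>{q. prime q \<and> int q dvd gcd (int n) (int k - 1)}. 1 - 1 / ((real q - 1)\<^sup>2 * (real q + 1)))
      * (\<Prod>q\<in>{q. prime q \<and> q dvd n \<and> \<not> int q dvd int k - 1}. 1 - 1 / (real q - 1)\<^sup>2)
      = (\<Prod>q\<in>prime_factors n. e q)"
  proof -
    have "{q. prime q \<and> int q dvd gcd (int n) (int k - 1)} = {q \<in> prime_factors n. int q dvd int k - 1}"
      "{q. prime q \<and> q dvd n \<and> \<not> int q dvd int k - 1} = {q \<in> prime_factors n. \<not> int q dvd int k - 1}"
      by (auto simp: pf)
    then show ?thesis
      by (simp add: e_def prod.If_cases Int_def)
  qed
  then have rhs: "C_prime n k = 1 / real (totient n) * ((if even n then e 2 else 1) * (\<Prod>q\<in>A. e q))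
      * ((if even n then 1 else 2 / 3) * T)"
    unfolding C_prime_def T_def prime_prod_koblitz_split_2[symmetric] split[symmetric]
    by (simp add: koblitz_factor_def[abs_def])
  show ?thesis unfolding lhs rhs by (cases "even n") (simp_all add: e2)
qed

end
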